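(* With the terms $M$ and $N$ of the symmetric $\lambda\mu$-calculus given by $M=\langle (x\;M_1),(x\;M_0)\rangle$ and $N=(\alpha\;\lambda z(\alpha\;z))$, where $M_0$, $M_1$ and the pairing $\langle\cdot,\cdot\rangle$ are the explicit terms defined in the context, one has $M[x:=\mu\alpha N]\in SN$ but $(\lambda x M\;\mu\alpha N)\notin SN$.
   Context: Terms of the (untyped) symmetric $\lambda\mu$-calculus are given by the grammar $\mathcal T ::= x \mid \lambda x\,\mathcal T \mid (\mathcal T\;\mathcal T) \mid \mu\alpha\,\mathcal T \mid (\alpha\;\mathcal T)$, where $x,y,\dots$ range over $\lambda$-variables and $\alpha,\beta,\dots$ over $\mu$-variables ($\lambda x$ binds $x$, $\mu\alpha$ binds $\alpha$; terms are taken up to renaming of bound variables, and substitutions are capture-avoiding). Application associates to the left: $(M\;N_1\dots N_n)$ means $((M\;N_1)\dots N_n)$. One-step reduction $\triangleright$ is the closure under all term contexts of the three rules ($\beta$) $(\lambda x M\;N)\triangleright M[x:=N]$; ($\mu$) $(\mu\alpha M\;N)\triangleright \mu\alpha\, M[\alpha=_r N]$; ($\mu'$) $(M\;\mu\alpha N)\triangleright \mu\alpha\, N[\alpha=_l M]$. Here $M[\alpha=_r N]$ is obtained from $M$ by (recursively) replacing each sub-term of $M$ of the form $(\alpha\;U)$ ($\alpha$ free) by $(\alpha\;(U\;N))$, and $N[\alpha=_l M]$ is obtained from $N$ by (recursively) replacing each sub-term of $N$ of the form $(\alpha\;U)$ by $(\alpha\;(M\;U))$. $SN$ is the set of terms having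 no infinite $\triangleright$-reduction sequence. Explicit terms: $\underline 0=\lambda x\lambda y\, y$, $\underline 1=\lambda x\lambda y\, x$, $\Delta=\lambda x (x\;x)$, $P=\lambda x\lambda y\lambda z\,\big(y\;(z\;\underline 1\;\underline 0)\;(z\;\underline 0\;\underline 1)\;(\lambda d\,\underline 1)\;\Delta\;\Delta\big)$, $M_0=\lambda x(x\;P\;\underline 0)$, $M_1=\lambda x(x\;P\;\underline 1)$. For terms $T_1,T_0$, $\langle T_1,T_0\rangle$ denotes the term $\lambda f(f\;T_1\;T_0)$ where $f$ is a fresh $\lambda$-variable. *)

theory Defs
  imports Main
begin

text \<open>
  Terms up to renaming of bound variables are represented by de Bruijn indices, with two
  independent index families: \<open>Var\<close> and \<open>Lam\<close> count only enclosing \<open>Lam\<close>s, while \<open>Named\<close> and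
  \<open>Mu\<close> count only enclosing \<open>Mu\<close>s. An index exceeding the number of enclosing binders of its
  kind is a free variable. \<open>Named \<alpha> t\<close> is the term \<open>(\<alpha> t)\<close>.
\<close>

datatype trm =
    Var nat
  | Lam trm
  | App trm trm  (infixl "\<degree>" 200)
  | Mu trm
  | Named nat trm

primrec lift_lam :: "trm \<Rightarrow> nat \<Rightarrow> trm" where
  "lift_lam (Var i) k = (if i < k then Var i else Var (Suc i))"
| "lift_lam (Lam t) k = Lam (lift_lam t (Suc k))"
| "lift_lam (s \<degree> t) k = lift_lam s k \<degree> lift_lam t k"
| "lift_lam (Mu t) k = Mu (lift_lam t k)"
| "lift_lam (Named a t) k = Named a (lift_lam t k)"

primrec lift_mu :: "trm \<Rightarrow> nat \<Rightarrow> trm" where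
  "lift_mu (Var i) k = Var i"
| "lift_mu (Lam t) k = Lam (lift_mu t k)"
| "lift_mu (s \<degree> t) k = lift_mu s k \<degree> lift_mu t k"
| "lift_mu (Mu t) k = Mu (lift_mu t (Suc k))"
| "lift_mu (Named a t) k = Named (if a < k then a else Suc a) (lift_mu t k)"

text \<open>
  \<open>subst t s k\<close> is the substitution used for \<beta>: it replaces the variable \<open>k\<close> by \<open>s\<close> and
  also removes the binder of \<open>k\<close>, so the indices above \<open>k\<close> are decremented.
\<close>

primrec subst :: "trm \<Rightarrow> trm \<Rightarrow> nat \<Rightarrow> trm" where
  "subst (Var i) s k = (if i < k then Var i else if i = k then s else Var (i - 1))"
| "subst (Lam t) s k = Lam (subst t (lift_lam s 0) (Suc k))"
| "subst (t \<degree> u) s k = subst t s k \<degree> subst u s k"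
| "subst (Mu t) s k = Mu (subst t (lift_mu s 0) k)"
| "subst (Named a t) s k = Named a (subst t s k)"

text \<open>
  The structural substitutions \<open>M[\<alpha> =\<^sub>r N]\<close> and \<open>N[\<alpha> =\<^sub>l M]\<close>. Unlike \<open>subst\<close> they keep the
  variable \<open>\<alpha>\<close>, so no index is decremented.
\<close>

primrec rsubst :: "trm \<Rightarrow> nat \<Rightarrow> trm \<Rightarrow> trm" where
  "rsubst (Var i) \<alpha> n = Var i"
| "rsubst (Lam t) \<alpha> n = Lam (rsubst t \<alpha> (lift_lam n 0))"
| "rsubst (t \<degree> u) \<alpha> n = rsubst t \<alpha> n \<degree> rsubst u \<alpha> n"
| "rsubst (Mu t) \<alpha> n = Mu (rsubst t (Suc \<alpha>) (lift_mu n 0))"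
| "rsubst (Named b u) \<alpha> n =
     Named b (if b = \<alpha> then rsubst u \<alpha> n \<degree> n else rsubst u \<alpha> n)"

primrec lsubst :: "trm \<Rightarrow> nat \<Rightarrow> trm \<Rightarrow> trm" where
  "lsubst (Var i) \<alpha> m = Var i"
| "lsubst (Lam t) \<alpha> m = Lam (lsubst t \<alpha> (lift_lam m 0))"
| "lsubst (t \<degree> u) \<alpha> m = lsubst t \<alpha> m \<degree> lsubst u \<alpha> m"
| "lsubst (Mu t) \<alpha> m = Mu (lsubst t (Suc \<alpha>) (lift_mu m 0))"
| "lsubst (Named b u) \<alpha> m =
     Named b (if b = \<alpha> then m \<degree> lsubst u \<alpha> m else lsubst u \<alpha> m)"

text \<open>
  In the rules \<open>mu\<close> and \<open>mu'\<close> the argument moves under the binder of \<open>\<alpha>\<close> (index \<open>0\<close> there),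
  hence the lifting.
\<close>

inductive red :: "trm \<Rightarrow> trm \<Rightarrow> bool"  (infix "\<triangleright>" 50) where
  beta: "Lam M \<degree> N \<triangleright> subst M N 0"
| mu: "Mu M \<degree> N \<triangleright> Mu (rsubst M 0 (lift_mu N 0))"
| mu': "M \<degree> Mu N \<triangleright> Mu (lsubst N 0 (lift_mu M 0))"
| Lam: "M \<triangleright> M' \<Longrightarrow> Lam M \<triangleright> Lam M'"
| appL: "M \<triangleright> M' \<Longrightarrow> M \<degree> N \<triangleright> M' \<degree> N"
| appR: "N \<triangleright> N' \<Longrightarrow> M \<degree> N \<triangleright> M \<degree> N'"
| Mu: "M \<triangleright> M' \<Longrightarrow> Mu M \<triangleright> Mu M'"
| Named: "M \<triangleright> M' \<Longrightarrow> Named a M \<triangleright> Named a M'"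

definition SN :: "trm set" where
  "SN = {t. \<not> (\<exists>s. s 0 = t \<and> (\<forall>i::nat. s i \<triangleright> s (Suc i)))}"

text \<open>\<open>\<lambda>x \<lambda>y y\<close> and \<open>\<lambda>x \<lambda>y x\<close>\<close>

definition zero_trm :: trm where
  "zero_trm = Lam (Lam (Var 0))"

definition one_trm :: trm where
  "one_trm = Lam (Lam (Var 1))"

definition Delta :: trm where
  "Delta = Lam (Var 0 \<degree> Var 0)"

text \<open>
  \<open>\<lambda>x \<lambda>y \<lambda>z (y (z 1 0) (z 0 1) (\<lambda>d 1) \<Delta> \<Delta>)\<close>; here \<open>y\<close> is \<open>Var 1\<close>, \<open>z\<close> is \<open>Var 0\<close>, and
  the constants are closed and so need no lifting.
\<close>

definition P_trm :: trm where
  "P_trm = Lam (Lam (Lam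
     (Var 1 \<degree> (Var 0 \<degree> one_trm \<degree> zero_trm) \<degree> (Var 0 \<degree> zero_trm \<degree> one_trm)
        \<degree> Lam one_trm \<degree> Delta \<degree> Delta)))"

definition M\<^sub>0 :: trm where
  "M\<^sub>0 = Lam (Var 0 \<degree> P_trm \<degree> zero_trm)"

definition M\<^sub>1 :: trm where
  "M\<^sub>1 = Lam (Var 0 \<degree> P_trm \<degree> one_trm)"

text \<open>\<open>\<lambda>f (f T1 T0)\<close>; lifting the components makes \<open>f\<close> fresh for them.\<close>

definition pair :: "trm \<Rightarrow> trm \<Rightarrow> trm"  ("\<langle>_,/ _\<rangle>") where
  "\<langle>T1, T0\<rangle> = Lam (Var 0 \<degree> lift_lam T1 0 \<degree> lift_lam T0 0)"

text \<open>
  The two terms of the counterexample, \<open>\<langle>(x M\<^sub>1), (x M\<^sub>0)\<rangle>\<close> and \<open>(\<alpha> \<lambda>z (\<alpha> z))\<close>. The free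
  variables \<open>x\<close> of the first and \<open>\<alpha>\<close> of the second are the ones with index \<open>0\<close>, so that
  \<open>\<lambda>x M\<close> and \<open>\<mu>\<alpha> N\<close> are \<open>Lam M_trm\<close> and \<open>Mu N_trm\<close>.
\<close>

definition M_trm :: trm where
  "M_trm = \<langle>Var 0 \<degree> M\<^sub>1, Var 0 \<degree> M\<^sub>0\<rangle>"

definition N_trm :: trm where
  "N_trm = Named 0 (Lam (Named 0 (Var 0)))"

end

theory Submission
  imports Defs
begin

text \<open>
  In \<open>M[x := \<mu>\<alpha> N] = \<lambda>f (f (\<mu>\<alpha> N M\<^sub>1) (\<mu>\<alpha> N M\<^sub>0))\<close> the closed terms
  \<open>M\<^sub>i\<close> meet only in the self-applications \<open>(M\<^sub>i M\<^sub>i)\<close>, which are strongly normalizing and,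
  being closed and free of \<open>\<mu>\<close>, cannot interact with their context. Everything else the two
  \<open>\<mu>\<close>-terms can do to each other is to copy \<open>f\<close> and each other boundedly often; this is controlled
  by induction on strong normalization of the two arguments, since \<open>f\<close> never becomes an abstraction.

  In \<open>(\<lambda>x M \<mu>\<alpha> N)\<close>, the rule \<open>mu'\<close> produces \<open>(\<lambda>x M \<lambda>z (\<alpha> (\<lambda>x M z)))\<close>. Contracting it puts
  \<open>M\<^sub>1\<close> as an argument of the inner copy of \<open>\<lambda>x M\<close>, whose components include \<open>M\<^sub>0\<close>: this creates
  the mixed application \<open>(M\<^sub>1 M\<^sub>0)\<close>, which reduces to \<open>(\<Delta> \<Delta>)\<close>.
\<close>

section \<open>Reduction and strong normalization\<close>

lemma red_Var_iff [simp]: "Var i \<triangleright> u \<longleftrightarrow> False"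
  by (auto elim: red.cases)

lemma red_Lam_iff [simp]: "Lam t \<triangleright> u \<longleftrightarrow> (\<exists>t'. u = Lam t' \<and> t \<triangleright> t')"
  by (auto elim: red.cases intro: red.intros)

lemma red_Mu_iff [simp]: "Mu t \<triangleright> u \<longleftrightarrow> (\<exists>t'. u = Mu t' \<and> t \<triangleright> t')"
  by (auto elim: red.cases intro: red.intros)

lemma red_Named_iff [simp]: "Named a t \<triangleright> u \<longleftrightarrow> (\<exists>t'. u = Named a t' \<and> t \<triangleright> t')"
  by (auto elim: red.cases intro: red.intros)

lemma red_App_iff:
  "s \<degree> t \<triangleright> u \<longleftrightarrow>
     (\<exists>M. s = Lam M \<and> u = subst M t 0) \<or>
     (\<exists>M. s = Mu M \<and> u = Mu (rsubst M 0 (lift_mu t 0))) \<or>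
     (\<exists>M. t = Mu M \<and> u = Mu (lsubst M 0 (lift_mu s 0))) \<or>
     (\<exists>s'. s \<triangleright> s' \<and> u = s' \<degree> t) \<or>
     (\<exists>t'. t \<triangleright> t' \<and> u = s \<degree> t')"
  by (auto elim: red.cases intro: red.intros)

text \<open>
  Hereditary version of strong normalization: every reduct, in any number of steps, satisfies \<open>Q\<close>.
  With \<open>Q\<close> excluding \<open>\<mu>\<close>-abstractions a term can never trigger the rule \<open>mu'\<close> as an argument.
\<close>

inductive hsn :: "(trm \<Rightarrow> bool) \<Rightarrow> trm \<Rightarrow> bool" for Q where
  hsnI: "Q t \<Longrightarrow> (\<And>u. t \<triangleright> u \<Longrightarrow> hsn Q u) \<Longrightarrow> hsn Q t"

abbreviation sn :: "trm \<Rightarrow> bool" where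
  "sn \<equiv> hsn (\<lambda>_. True)"

lemma hsn_red: "hsn Q t \<Longrightarrow> t \<triangleright> u \<Longrightarrow> hsn Q u"
  by (auto elim: hsn.cases)

lemma hsn_reds: "red\<^sup>*\<^sup>* t u \<Longrightarrow> hsn Q t \<Longrightarrow> hsn Q u"
  by (induction rule: rtranclp_induct) (auto intro: hsn_red)

lemma hsn_mono: "hsn Q t \<Longrightarrow> (\<And>t. Q t \<Longrightarrow> Q' t) \<Longrightarrow> hsn Q' t"
  by (induction rule: hsn.induct) (auto intro: hsnI)

lemma sn_imp_SN: "sn t \<Longrightarrow> t \<in> SN"
proof (induction rule: hsn.induct)
  case (hsnI t)
  have False if s: "s 0 = t" "\<And>i. s i \<triangleright> s (Suc i)" for s
  proof -
    have "t \<triangleright> s (Suc 0)" using s(2)[of 0] s(1) by simp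
    then have "s (Suc 0) \<in> SN" by (rule hsnI.IH)
    moreover have "s (Suc 0) \<notin> SN"
      unfolding SN_def mem_Collect_eq not_not
      by (rule exI[of _ "\<lambda>i. s (Suc i)"]) (simp add: s)
    ultimately show False by contradiction
  qed
  then show ?case unfolding SN_def by auto
qed

lemma sn_Lam: "sn t \<Longrightarrow> sn (Lam t)"
  by (induction rule: hsn.induct) (rule hsnI, auto)

lemma sn_Mu: "sn t \<Longrightarrow> sn (Mu t)"
  by (induction rule: hsn.induct) (rule hsnI, auto)

lemma hsn_Named:
  assumes "sn t" and "\<And>t. Q (Named a t)"
  shows "hsn Q (Named a t)"
  using assms(1) by (induction rule: hsn.induct) (rule hsnI, auto simp: assms(2))

definition noMu :: "trm \<Rightarrow> bool" where
  "noMu t \<longleftrightarrow> (\<forall>M. t \<noteq> Mu M)"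

text \<open>At the head of an application such a term triggers neither \<open>beta\<close> nor
  \<open>mu\<close>.\<close>

definition neutral :: "trm \<Rightarrow> bool" where
  "neutral t \<longleftrightarrow> (\<forall>M. t \<noteq> Mu M \<and> t \<noteq> Lam M)"

lemma noMu_simps [simp]:
  "noMu (Var i)" "noMu (Lam t)" "noMu (s \<degree> t)" "noMu (Named a t)" "\<not> noMu (Mu t)"
  by (auto simp: noMu_def)

lemma neutral_simps [simp]:
  "neutral (Var i)" "\<not> neutral (Lam t)" "neutral (s \<degree> t)" "neutral (Named a t)" "\<not> neutral (Mu t)"
  by (auto simp: neutral_def)

lemma hsn_imp_sn: "hsn Q t \<Longrightarrow> sn t"
  by (erule hsn_mono) simp

lemma hsn_neutral_Var: "hsn neutral (Var n)"
  by (auto intro: hsnI)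

text \<open>No rule fires at the root of such an application, so each step is a step of one of the
  two parts; the nested induction follows both.\<close>

lemma hsn_neutral_App:
  assumes "hsn neutral s" and "hsn noMu t"
  shows "hsn neutral (s \<degree> t)"
  using assms
proof (induction arbitrary: t rule: hsn.induct)
  case (hsnI s)
  note s = hsnI
  from hsnI.prems show ?case
  proof (induction rule: hsn.induct)
    case (hsnI t)
    show ?case
    proof (rule hsn.hsnI)
      fix u assume "s \<degree> t \<triangleright> u"
      then show "hsn neutral u"
        using s(1,3) hsnI by (auto simp: red_App_iff intro: hsn.hsnI)
    qed simp
  qed
qed

section \<open>Substitution and reduction\<close>

lemma lift_mu_lift_mu: "i \<le> k \<Longrightarrow> lift_mu (lift_mu t i) (Suc k) = lift_mu (lift_mu t k) i"
  by (induction t arbitrary: i k) auto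

lemma lift_mu_lift_lam: "lift_mu (lift_lam t i) k = lift_lam (lift_mu t k) i"
  by (induction t arbitrary: i k) auto

lemma lift_mu_subst: "lift_mu (subst t s j) k = subst (lift_mu t k) (lift_mu s k) j"
  by (induction t arbitrary: s j k) (auto simp: lift_mu_lift_lam lift_mu_lift_mu)

lemma lift_mu_rsubst:
  "a \<le> k \<Longrightarrow> lift_mu (rsubst t a s) (Suc k) = rsubst (lift_mu t (Suc k)) a (lift_mu s (Suc k))"
  by (induction t arbitrary: s a k) (auto simp: lift_mu_lift_lam lift_mu_lift_mu)

lemma lift_mu_lsubst:
  "a \<le> k \<Longrightarrow> lift_mu (lsubst t a s) (Suc k) = lsubst (lift_mu t (Suc k)) a (lift_mu s (Suc k))"
  by (induction t arbitrary: s a k) (auto simp: lift_mu_lift_lam lift_mu_lift_mu)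

lemma lift_mu_eq_iff:
  "lift_mu t k = Lam M \<longleftrightarrow> (\<exists>M'. t = Lam M' \<and> M = lift_mu M' k)"
  "lift_mu t k = Mu M \<longleftrightarrow> (\<exists>M'. t = Mu M' \<and> M = lift_mu M' (Suc k))"
  by (cases t; auto)+

text \<open>Lifting only renames \<mu>-variables, so it creates no redexes. This carries strong
  normalization over to the lifted copies that the structural rules place under the binder.\<close>

lemma red_lift_mu_reflect:
  "lift_mu t k \<triangleright> u \<Longrightarrow> \<exists>t'. u = lift_mu t' k \<and> t \<triangleright> t'"
proof (induction t arbitrary: k u)
  case (App s t)
  from App.prems have "lift_mu s k \<degree> lift_mu t k \<triangleright> u" by simp
  then consider
      (beta) M where "s = Lam M" "u = subst (lift_mu M k) (lift_mu t k) 0"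
    | (mu) M where "s = Mu M" "u = Mu (rsubst (lift_mu M (Suc k)) 0 (lift_mu (lift_mu t k) 0))"
    | (mu') M where "t = Mu M" "u = Mu (lsubst (lift_mu M (Suc k)) 0 (lift_mu (lift_mu s k) 0))"
    | (l) s' where "s \<triangleright> s'" "u = lift_mu s' k \<degree> lift_mu t k"
    | (r) t' where "t \<triangleright> t'" "u = lift_mu s k \<degree> lift_mu t' k"
    unfolding red_App_iff using App.IH by (fastforce simp: lift_mu_eq_iff)
  then show ?case
  proof cases
    case beta
    then have "u = lift_mu (subst M t 0) k" by (simp add: lift_mu_subst)
    with beta show ?thesis by (blast intro: red.intros)
  next
    case mu
    then have "u = lift_mu (Mu (rsubst M 0 (lift_mu t 0))) k"
      by (simp add: lift_mu_rsubst lift_mu_lift_mu)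
    with mu show ?thesis by (blast intro: red.intros)
  next
    case mu'
    then have "u = lift_mu (Mu (lsubst M 0 (lift_mu s 0))) k"
      by (simp add: lift_mu_lsubst lift_mu_lift_mu)
    with mu' show ?thesis by (blast intro: red.intros)
  next
    case l
    then have "u = lift_mu (s' \<degree> t) k" by simp
    with l show ?thesis by (blast intro: red.intros)
  next
    case r
    then have "u = lift_mu (s \<degree> t') k" by simp
    with r show ?thesis by (blast intro: red.intros)
  qed
next
  case (Lam t)
  then obtain t' where "u = lift_mu (Lam t') k" "t \<triangleright> t'" by fastforce
  then show ?case by (blast intro: red.intros)
next
  case (Mu t)
  then obtain t' where "u = lift_mu (Mu t') k" "t \<triangleright> t'" by fastforce
  then show ?case by (blast intro: red.intros)
next
  case (Named a t)
  then obtain t' where "u = lift_mu (Named a t') k" "t \<triangleright> t'" by fastforce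
  then show ?case by (blast intro: red.intros)
qed simp

lemma hsn_lift_mu:
  assumes "hsn Q t" and "\<And>t. Q t \<Longrightarrow> Q (lift_mu t k)"
  shows "hsn Q (lift_mu t k)"
  using assms
proof (induction rule: hsn.induct)
  case (hsnI t)
  show ?case
  proof (rule hsn.hsnI)
    fix u assume "lift_mu t k \<triangleright> u"
    then obtain t' where "u = lift_mu t' k" "t \<triangleright> t'" using red_lift_mu_reflect by blast
    then show "hsn Q u" using hsnI by blast
  qed (use hsnI in blast)
qed

lemma noMu_lift_mu: "noMu t \<Longrightarrow> noMu (lift_mu t k)"
  by (cases t) auto

lemma neutral_lift_mu: "neutral t \<Longrightarrow> neutral (lift_mu t k)"
  by (cases t) auto

lemma subst_lift_lam: "subst (lift_lam t k) s k = t"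
  by (induction t arbitrary: s k) auto

text \<open>Excluding \<open>Mu\<close> and \<open>Named\<close> makes these terms immune to
  \<mu>-lifting and to both structural substitutions, and reduction preserves the class.\<close>

primrec lclosed :: "nat \<Rightarrow> trm \<Rightarrow> bool" where
  "lclosed k (Var i) \<longleftrightarrow> i < k"
| "lclosed k (Lam t) \<longleftrightarrow> lclosed (Suc k) t"
| "lclosed k (s \<degree> t) \<longleftrightarrow> lclosed k s \<and> lclosed k t"
| "lclosed k (Mu t) \<longleftrightarrow> False"
| "lclosed k (Named a t) \<longleftrightarrow> False"

lemma lclosed_lift_lam: "lclosed k t \<Longrightarrow> k \<le> j \<Longrightarrow> lift_lam t j = t"
  by (induction t arbitrary: k j) auto

lemma lclosed_lift_mu: "lclosed k t \<Longrightarrow> lift_mu t j = t"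
  by (induction t arbitrary: k j) auto

lemma lclosed_subst: "lclosed k t \<Longrightarrow> k \<le> j \<Longrightarrow> subst t s j = t"
  by (induction t arbitrary: k j s) auto

lemma lclosed_rsubst: "lclosed k t \<Longrightarrow> rsubst t a s = t"
  by (induction t arbitrary: k a s) auto

lemma lclosed_lsubst: "lclosed k t \<Longrightarrow> lsubst t a s = t"
  by (induction t arbitrary: k a s) auto

lemmas lclosed_simps [simp] =
  lclosed_lift_lam[of 0, simplified] lclosed_lift_mu[of 0] lclosed_subst[of 0, simplified]
  lclosed_rsubst[of 0] lclosed_lsubst[of 0]

lemma lclosed_weaken_lift: "lclosed k s \<Longrightarrow> lclosed (Suc k) (lift_lam s j)"
  by (induction s arbitrary: k j) auto

lemma lclosed_subst_closed:
  "lclosed (Suc k) t \<Longrightarrow> lclosed k s \<Longrightarrow> j \<le> k \<Longrightarrow> lclosed k (subst t s j)"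
  by (induction t arbitrary: k s j) (auto simp: lclosed_weaken_lift)

lemma lclosed_red: "t \<triangleright> u \<Longrightarrow> lclosed k t \<Longrightarrow> lclosed k u"
  by (induction arbitrary: k rule: red.induct) (auto simp: lclosed_subst_closed)

lemma lclosed_reds: "red\<^sup>*\<^sup>* t u \<Longrightarrow> lclosed k t \<Longrightarrow> lclosed k u"
  by (induction rule: rtranclp_induct) (auto intro: lclosed_red)

text \<open>An \<open>lclosed\<close> term contains no \<open>Mu\<close> at all, and reduction
  cannot introduce one.\<close>

lemma hsn_noMu_lclosed: "sn t \<Longrightarrow> lclosed k t \<Longrightarrow> hsn noMu t"
proof (induction rule: hsn.induct)
  case (hsnI t)
  then have "noMu t" by (cases t) auto
  then show ?case using hsnI lclosed_red by (blast intro: hsn.hsnI)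
qed

section \<open>Substitution of a closed pure \<lambda>-term\<close>

context
  fixes K :: trm
  assumes K: "lclosed 0 K"
begin

lemma lift_mu_subst_closed: "lift_mu (subst t K j) k = subst (lift_mu t k) K j"
  using K by (simp add: lift_mu_subst)

lemma lift_lam_subst_closed:
  "i \<le> j \<Longrightarrow> lift_lam (subst t K j) i = subst (lift_lam t i) K (Suc j)"
  using K by (induction t arbitrary: i j) auto

lemma subst_rsubst_closed: "subst (rsubst t a s) K k = rsubst (subst t K k) a (subst s K k)"
  using K
  by (induction t arbitrary: a s k) (auto simp: lift_mu_subst_closed lift_lam_subst_closed)

lemma subst_lsubst_closed: "subst (lsubst t a s) K k = lsubst (subst t K k) a (subst s K k)"
  using K
  by (induction t arbitrary: a s k) (auto simp: lift_mu_subst_closed lift_lam_subst_closed)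

lemma subst_subst_closed:
  "j \<le> k \<Longrightarrow> subst (subst t s j) K k = subst (subst t K (Suc k)) (subst s K k) j"
  using K
  by (induction t arbitrary: s j k) (auto simp: lift_mu_subst_closed lift_lam_subst_closed)

lemma red_subst_closed: "t \<triangleright> u \<Longrightarrow> subst t K k \<triangleright> subst u K k"
proof (induction arbitrary: k rule: red.induct)
  case (beta M N)
  then show ?case using K red.beta[of "subst M K (Suc k)" "subst N K k"]
    by (simp add: subst_subst_closed)
next
  case (mu M N)
  then show ?case using K red.mu[of "subst M K k" "subst N K k"]
    by (simp add: subst_rsubst_closed lift_mu_subst_closed)
next
  case (mu' M N)
  then show ?case using K red.mu'[of "subst M K k" "subst N K k"]
    by (simp add: subst_lsubst_closed lift_mu_subst_closed)
qed (use K in \<open>auto intro: red.intros\<close>)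

text \<open>Since \<open>K\<close> is normal and not a \<open>Mu\<close>, the redex can only be
  contracted or step inside \<open>u\<close>. By \<open>red_subst_closed\<close> the latter is
  mirrored by a step of the contractum, so induction on the contractum suffices.\<close>

lemma hsn_beta_expand:
  assumes "hsn Q (subst u K 0)" and "\<And>u. \<not> K \<triangleright> u" and "\<And>s t. Q (s \<degree> t)"
  shows "hsn Q (Lam u \<degree> K)"
  using assms
proof (induction "subst u K 0" arbitrary: u rule: hsn.induct)
  case hsnI
  show ?case
  proof (rule hsn.hsnI)
    fix v assume "Lam u \<degree> K \<triangleright> v"
    moreover have "K \<noteq> Mu M" for M using K by auto
    ultimately consider "v = subst u K 0" | u' where "v = Lam u' \<degree> K" "u \<triangleright> u'"
      using hsnI.prems by (auto simp: red_App_iff)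
    then show "hsn Q v"
    proof cases
      case 1
      moreover have "hsn Q (subst u K 0)" using hsnI.hyps(1,2) by (rule hsn.hsnI)
      ultimately show ?thesis by simp
    next
      case 2
      then show ?thesis using hsnI red_subst_closed by auto
    qed
  qed (rule hsnI)
qed

end

section \<open>The argument terms\<close>

text \<open>The properties shared by \<open>M\<^sub>0\<close> and \<open>M\<^sub>1\<close>. Only
  self-application is assumed to terminate, as the mixed application
  \<open>M\<^sub>1 \<degree> M\<^sub>0\<close> diverges.\<close>

locale argument =
  fixes K :: trm
  assumes closed: "lclosed 0 K"
    and normal: "\<And>u. \<not> K \<triangleright> u"
    and sn_self: "sn (K \<degree> K)"
begin

lemma reds_closed: "red\<^sup>*\<^sup>* (K \<degree> K) p \<Longrightarrow> lclosed 0 p"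
  using closed by (auto intro: lclosed_reds)

lemma reds_hsn: "red\<^sup>*\<^sup>* (K \<degree> K) p \<Longrightarrow> hsn noMu p"
  using hsn_reds[OF _ sn_self] reds_closed hsn_noMu_lclosed by blast

text \<open>The reducts of \<open>(\<mu>\<alpha> N K)\<close>.\<close>

inductive stage :: "trm \<Rightarrow> bool" where
  "stage (Mu N_trm \<degree> K)"
| "stage (Mu (Named 0 (Lam (Named 0 (Var 0 \<degree> K)) \<degree> K)))"
| "red\<^sup>*\<^sup>* (K \<degree> K) p \<Longrightarrow> stage (Mu (Named 0 (Named 0 p)))"

lemma stage_red: "stage t \<Longrightarrow> t \<triangleright> u \<Longrightarrow> stage u"
  by (induction rule: stage.induct)
     (use closed normal in \<open>auto simp: red_App_iff N_trm_def intro: stage.intros rtranclp.intros\<close>)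

lemma stage_lift_mu: "stage t \<Longrightarrow> lift_mu t k = t"
  by (induction rule: stage.induct) (use closed in \<open>auto simp: N_trm_def reds_closed\<close>)

text \<open>The third form inherits termination from \<open>K \<degree> K\<close>, the second is a
  \<beta>-expansion over \<open>K \<degree> K\<close>, and the first can only make its
  \<open>mu\<close> step, which leaves that form for good.\<close>

lemma sn_stage: "stage t \<Longrightarrow> sn t"
proof -
  have 3: "sn (Mu (Named 0 (Named 0 p)))" if "red\<^sup>*\<^sup>* (K \<degree> K) p" for p
    using reds_hsn[OF that] by (auto intro!: sn_Mu hsn_Named intro: hsn_imp_sn)
  have 2: "sn (Mu (Named 0 (Lam (Named 0 (Var 0 \<degree> K)) \<degree> K)))"
    using closed normal sn_self by (auto intro!: sn_Mu hsn_Named hsn_beta_expand)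
  have "stage u \<Longrightarrow> u \<noteq> Mu N_trm \<degree> K \<Longrightarrow> sn u" for u
    using 2 3 by (auto elim: stage.cases)
  moreover have "u \<noteq> Mu N_trm \<degree> K" if "Mu N_trm \<degree> K \<triangleright> u" for u
    using that closed normal by (auto simp: red_App_iff N_trm_def)
  ultimately have "sn (Mu N_trm \<degree> K)"
    by (blast intro: hsnI stage_red stage.intros)
  then show "stage t \<Longrightarrow> sn t" using 2 3 by (auto elim: stage.cases)
qed

text \<open>Both occurrences of \<alpha> receive \<open>s\<close>: the outer copy becomes the head,
  the inner one ends up inside \<open>Y\<close>, where it only meets reducts of
  \<open>K \<degree> K\<close>. Thus a \<open>mu'\<close> step leads back to applying
  \<open>s\<close> to an argument that never becomes a \<open>Mu\<close>.\<close>

lemma stage_lsubst: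
  assumes "stage (Mu C)" and "\<And>q. red\<^sup>*\<^sup>* (K \<degree> K) q \<Longrightarrow> sn (s \<degree> q)"
  obtains Y where "lsubst C 0 s = Named 0 (s \<degree> Y)" and "hsn noMu Y"
  using assms(1)
proof (cases rule: stage.cases)
  case 2
  have "hsn noMu (Lam (Named 0 (lift_lam s 0 \<degree> (Var 0 \<degree> K))) \<degree> K)"
    using closed normal assms(2)[of "K \<degree> K"]
    by (auto intro!: hsn_beta_expand hsn_Named simp: subst_lift_lam)
  then show ?thesis using 2 closed that by auto
next
  case (3 p)
  then have "hsn noMu (Named 0 (s \<degree> p))" using assms(2) by (auto intro: hsn_Named)
  then show ?thesis using 3 that reds_closed by auto
qed

text \<open>Only \<open>mu'\<close> can fire at the root, and \<open>stage_lsubst\<close> brings its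
  contractum within reach of \<open>hsn_neutral_App\<close>. The outer induction is on
  \<open>s\<close>, the inner one on \<open>t\<close>.\<close>

lemma sn_neutral_stage:
  assumes "hsn neutral s" and "stage t"
  shows "sn (s \<degree> t)"
  using assms
proof (induction arbitrary: t rule: hsn.induct)
  case (hsnI s)
  note s = hsnI
  from s(4) have "sn t" by (rule sn_stage)
  from this s(4) show ?case
  proof (induction rule: hsn.induct)
    case (hsnI t)
    show ?case
    proof (rule hsn.hsnI)
      fix u assume "s \<degree> t \<triangleright> u"
      then consider (mu') C where "t = Mu C" "u = Mu (lsubst C 0 (lift_mu s 0))"
        | (l) s' where "s \<triangleright> s'" "u = s' \<degree> t" | (r) t' where "t \<triangleright> t'" "u = s \<degree> t'"
        using s(1) by (auto simp: red_App_iff)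
      then show "sn u"
      proof cases
        case mu'
        have s': "hsn neutral (lift_mu s 0)"
          using s(1,2) by (auto intro: hsn_lift_mu hsn.hsnI neutral_lift_mu)
        obtain Y where "lsubst C 0 (lift_mu s 0) = Named 0 (lift_mu s 0 \<degree> Y)" and "hsn noMu Y"
          using stage_lsubst[of C "lift_mu s 0"] mu' hsnI.prems hsn_imp_sn[OF hsn_neutral_App[OF s' reds_hsn]]
          by metis
        with mu' s' show ?thesis
          by (auto intro!: sn_Mu hsn_Named intro: hsn_imp_sn hsn_neutral_App)
      next
        case l
        then show ?thesis using s(3) hsnI.prems by auto
      next
        case r
        then show ?thesis using hsnI stage_red by auto
      qed
    qed simp
  qed
qed

text \<open>The reducts of \<open>(f (\<mu>\<alpha> N K))\<close> for the variable \<open>f\<close> of index \<open>n\<close>.\<close>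

inductive fstage :: "nat \<Rightarrow> trm \<Rightarrow> bool" for n where
  "stage t \<Longrightarrow> fstage n (Var n \<degree> t)"
| "fstage n (Mu (Named 0 (Var n \<degree> (Lam (Named 0 (Var (Suc n) \<degree> (Var 0 \<degree> K))) \<degree> K))))"
| "red\<^sup>*\<^sup>* (K \<degree> K) p \<Longrightarrow> fstage n (Mu (Named 0 (Var n \<degree> Named 0 (Var n \<degree> p))))"

lemma fstage_lift_mu: "fstage n t \<Longrightarrow> lift_mu t k = t"
  by (induction rule: fstage.induct) (use closed in \<open>auto simp: stage_lift_mu reds_closed\<close>)

lemma fstage_red: "fstage n t \<Longrightarrow> t \<triangleright> u \<Longrightarrow> fstage n u"
proof (induction rule: fstage.induct)
  case (1 t)
  then consider (mu') C where "t = Mu C" "u = Mu (lsubst C 0 (Var n))"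
    | (r) t' where "t \<triangleright> t'" "u = Var n \<degree> t'"
    by (auto simp: red_App_iff)
  then show ?case
  proof cases
    case mu'
    with 1 closed show ?thesis
      by (auto elim!: stage.cases simp: reds_closed intro: fstage.intros)
  next
    case r
    then show ?thesis using 1 stage_red by (auto intro: fstage.intros)
  qed
next
  case 2
  then show ?case using closed normal
    by (auto simp: red_App_iff intro: fstage.intros)
next
  case (3 p)
  have "p \<noteq> Mu C" for C using reds_closed[OF 3(1)] by auto
  then show ?case using 3
    by (auto simp: red_App_iff intro: fstage.intros rtranclp.intros)
qed

lemma fstage_not_Lam: "\<not> fstage n (Lam t)"
  by (auto elim: fstage.cases)

lemma sn_fstage: "fstage n s \<Longrightarrow> sn s"
proof (induction rule: fstage.induct)
  case (1 t)
  then show ?case by (auto intro: sn_neutral_stage hsn_neutral_Var)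
next
  case 2
  have "hsn noMu (Lam (Named 0 (Var (Suc n) \<degree> (Var 0 \<degree> K))) \<degree> K)"
    using closed normal
    by (auto intro!: hsn_beta_expand hsn_Named hsn_imp_sn[OF hsn_neutral_App[OF hsn_neutral_Var reds_hsn]])
  then show ?case
    by (intro sn_Mu hsn_Named hsn_neutral_Var hsn_imp_sn[OF hsn_neutral_App]) auto
next
  case (3 p)
  have "hsn noMu (Named 0 (Var n \<degree> p))"
    by (rule hsn_Named[OF hsn_imp_sn[OF hsn_neutral_App[OF hsn_neutral_Var reds_hsn[OF 3]]]]) simp
  then have "sn (Var n \<degree> Named 0 (Var n \<degree> p))"
    by (rule hsn_imp_sn[OF hsn_neutral_App[OF hsn_neutral_Var]])
  then show ?case by (simp add: sn_Mu hsn_Named)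
qed

text \<open>Mirror image of \<open>stage_lsubst\<close>: a \<open>mu\<close> step hands
  \<open>u\<close> to both occurrences of \<alpha>, and the outer copy is left as argument of a
  neutral term.\<close>

lemma fstage_rsubst:
  assumes "fstage n (Mu C)" and "\<And>q. red\<^sup>*\<^sup>* (K \<degree> K) q \<Longrightarrow> sn (Var n \<degree> q \<degree> u)"
  obtains X where "rsubst C 0 u = Named 0 (Var n \<degree> X \<degree> u)" and "hsn noMu X"
  using assms(1)
proof (cases rule: fstage.cases)
  case 2
  have "hsn noMu (Lam (Named 0 (Var (Suc n) \<degree> (Var 0 \<degree> K) \<degree> lift_lam u 0)) \<degree> K)"
    using closed normal assms(2)[of "K \<degree> K"]
    by (auto intro!: hsn_beta_expand hsn_Named simp: subst_lift_lam)
  then show ?thesis using 2 closed that by auto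
next
  case (3 p)
  then have "hsn noMu (Named 0 (Var n \<degree> p \<degree> u))" using assms(2) by (auto intro: hsn_Named)
  then show ?thesis using 3 that reds_closed by auto
qed

text \<open>The argument never becomes a \<open>Mu\<close> and \<open>s\<close> never a
  \<open>Lam\<close>, so at the root only \<open>mu\<close> can fire; its contractum consists of a
  variable applied to harmless arguments.\<close>

lemma sn_fstage_noMu:
  assumes "fstage n s" and "hsn noMu t"
  shows "sn (s \<degree> t)"
  using sn_fstage[OF assms(1)] assms
proof (induction arbitrary: t rule: hsn.induct)
  case (hsnI s)
  note s = hsnI
  from s(5) show ?case
  proof (induction rule: hsn.induct)
    case (hsnI t)
    show ?case
    proof (rule hsn.hsnI)
      fix u assume "s \<degree> t \<triangleright> u"
      then consider (mu) C where "s = Mu C" "u = Mu (rsubst C 0 (lift_mu t 0))"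
        | (l) s' where "s \<triangleright> s'" "u = s' \<degree> t" | (r) t' where "t \<triangleright> t'" "u = s \<degree> t'"
        using s(4) hsnI.hyps(1) by (auto simp: red_App_iff fstage_not_Lam)
      then show "sn u"
      proof cases
        case mu
        have t': "hsn noMu (lift_mu t 0)"
          using hsnI.hyps by (auto intro: hsn_lift_mu hsn.hsnI noMu_lift_mu)
        have app: "sn (Var n \<degree> q \<degree> lift_mu t 0)" if "hsn noMu q" for q
          using that t' by (intro hsn_imp_sn[OF hsn_neutral_App] hsn_neutral_App hsn_neutral_Var)
        obtain X where "rsubst C 0 (lift_mu t 0) = Named 0 (Var n \<degree> X \<degree> lift_mu t 0)" and "hsn noMu X"
          using fstage_rsubst[of n C "lift_mu t 0"] mu s(4) app reds_hsn by metis
        with mu app show ?thesis by (auto intro!: sn_Mu hsn_Named)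
      next
        case l
        have "hsn noMu t" using hsnI.hyps by (rule hsn.hsnI)
        with l show ?thesis using s(3,4) fstage_red by auto
      next
        case r
        then show ?thesis using hsnI by auto
      qed
    qed simp
  qed
qed

end

text \<open>Here both structural rules compete at the root, but each leads to a settled shape:
  \<open>mu\<close> to a neutral term applied to a stage, \<open>mu'\<close> to an
  \<open>fstage\<close> applied to a term that never becomes a \<open>Mu\<close>. \<open>K\<close>
  and \<open>K'\<close> are never applied to each other.\<close>

lemma sn_fstage_stage:
  assumes "argument K" and "argument K'"
    and "argument.fstage K n s" and "argument.stage K' t"
  shows "sn (s \<degree> t)"
proof -
  interpret f: argument K by fact
  interpret g: argument K' by fact
  show ?thesis
    using f.sn_fstage[OF assms(3)] assms(3,4)
  proof (induction arbitrary: t rule: hsn.induct)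
    case (hsnI s)
    note s = hsnI
    from g.sn_stage[OF s(5)] s(5) show ?case
    proof (induction rule: hsn.induct)
      case (hsnI t)
      show ?case
      proof (rule hsn.hsnI)
        fix u assume "s \<degree> t \<triangleright> u"
        then consider (mu) C where "s = Mu C" "u = Mu (rsubst C 0 t)"
          | (mu') C where "t = Mu C" "u = Mu (lsubst C 0 s)"
          | (l) s' where "s \<triangleright> s'" "u = s' \<degree> t" | (r) t' where "t \<triangleright> t'" "u = s \<degree> t'"
          using s(4) hsnI.prems
          by (auto simp: red_App_iff f.fstage_not_Lam f.fstage_lift_mu g.stage_lift_mu)
        then show "sn u"
        proof cases
          case mu
          have app: "sn (Var n \<degree> q \<degree> t)" if "hsn noMu q" for q
            using that hsnI.prems
            by (intro g.sn_neutral_stage hsn_neutral_App hsn_neutral_Var)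
          obtain X where "rsubst C 0 t = Named 0 (Var n \<degree> X \<degree> t)" and "hsn noMu X"
            using f.fstage_rsubst[of n C t] mu s(4) app f.reds_hsn by metis
          with mu app show ?thesis by (auto intro!: sn_Mu hsn_Named)
        next
          case mu'
          obtain Y where "lsubst C 0 s = Named 0 (s \<degree> Y)" and "hsn noMu Y"
            using g.stage_lsubst[of C s] mu' hsnI.prems f.sn_fstage_noMu[OF s(4)] g.reds_hsn
            by metis
          with mu' show ?thesis using f.sn_fstage_noMu[OF s(4)]
            by (auto intro!: sn_Mu hsn_Named)
        next
          case l
          then show ?thesis using s f.fstage_red hsnI.prems by auto
        next
          case r
          then show ?thesis using hsnI g.stage_red by auto
        qed
      qed simp
    qed
  qed
qed

section \<open>The two concrete arguments\<close>

primrec reducts :: "trm \<Rightarrow> trm list" where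
  "reducts (Var i) = []"
| "reducts (Lam t) = map Lam (reducts t)"
| "reducts (s \<degree> t) =
     (case s of Lam M \<Rightarrow> [subst M t 0] | Mu M \<Rightarrow> [Mu (rsubst M 0 (lift_mu t 0))] | _ \<Rightarrow> []) @
     (case t of Mu M \<Rightarrow> [Mu (lsubst M 0 (lift_mu s 0))] | _ \<Rightarrow> []) @
     map (\<lambda>s'. s' \<degree> t) (reducts s) @ map (\<lambda>t'. s \<degree> t') (reducts t)"
| "reducts (Mu t) = map Mu (reducts t)"
| "reducts (Named a t) = map (Named a) (reducts t)"

lemma set_reducts: "set (reducts t) = {u. t \<triangleright> u}"
  by (induction t) (auto simp: red_App_iff split: trm.splits)

text \<open>A computable certificate of termination: \<open>n\<close> must exceed the length of
  every reduction, since even a normal term needs budget one.\<close>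

primrec bounded :: "nat \<Rightarrow> trm \<Rightarrow> bool" where
  "bounded 0 t \<longleftrightarrow> False"
| "bounded (Suc n) t \<longleftrightarrow> list_all (bounded n) (reducts t)"

lemma bounded_imp_sn: "bounded n t \<Longrightarrow> sn t"
  by (induction n arbitrary: t) (auto simp: list_all_iff set_reducts intro: hsnI)

text \<open>\<open>P_trm\<close> tests its last two Boolean arguments for equality: the result is
  \<open>one_trm\<close> if they agree and \<open>Delta \<degree> Delta\<close> if not. A
  self-application compares a Boolean with itself.\<close>

lemma bounded_self:
  "bounded 30 (M\<^sub>0 \<degree> M\<^sub>0)" "bounded 30 (M\<^sub>1 \<degree> M\<^sub>1)"
  by code_simp+

lemma argument_M:
  "argument M\<^sub>0" "argument M\<^sub>1"
  using bounded_self[THEN bounded_imp_sn]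
  by (simp_all add: argument_def)
     (auto simp: M\<^sub>0_def M\<^sub>1_def P_trm_def zero_trm_def one_trm_def Delta_def red_App_iff)

section \<open>Non-termination\<close>

lemma not_SN_red:
  assumes "t \<triangleright> u" and "u \<notin> SN"
  shows "t \<notin> SN"
proof -
  from assms(2) obtain s where "s 0 = u" "\<forall>i. s i \<triangleright> s (Suc i)" by (auto simp: SN_def)
  then have "(case_nat t s) 0 = t \<and> (\<forall>i. case_nat t s i \<triangleright> case_nat t s (Suc i))"
    using assms(1) by (auto split: nat.split)
  then show ?thesis unfolding SN_def by blast
qed

lemma not_SN_context:
  assumes "\<And>s t. s \<triangleright> t \<Longrightarrow> C s \<triangleright> C t" and "t \<notin> SN"
  shows "C t \<notin> SN"
proof -
  from assms(2) obtain s where "s 0 = t" "\<forall>i. s i \<triangleright> s (Suc i)" by (auto simp: SN_def)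
  then have "(\<lambda>i. C (s i)) 0 = C t \<and> (\<forall>i. C (s i) \<triangleright> C (s (Suc i)))"
    using assms(1) by auto
  then show ?thesis unfolding SN_def mem_Collect_eq not_not by (rule exI[of _ "\<lambda>i. C (s i)"])
qed

lemma not_SN_Lam: "t \<notin> SN \<Longrightarrow> Lam t \<notin> SN"
  by (erule not_SN_context[rotated]) simp

lemma not_SN_Mu: "t \<notin> SN \<Longrightarrow> Mu t \<notin> SN"
  by (erule not_SN_context[rotated]) simp

lemma not_SN_Named: "t \<notin> SN \<Longrightarrow> Named a t \<notin> SN"
  by (erule not_SN_context[rotated]) simp

lemma not_SN_appL: "s \<notin> SN \<Longrightarrow> s \<degree> t \<notin> SN"
  by (erule not_SN_context[of "\<lambda>s. s \<degree> t", rotated]) (rule red.appL)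

lemma not_SN_appR: "t \<notin> SN \<Longrightarrow> s \<degree> t \<notin> SN"
  by (erule not_SN_context[rotated]) (rule red.appR)

lemma Delta_Delta_not_SN: "Delta \<degree> Delta \<notin> SN"
proof -
  have "Delta \<degree> Delta \<triangleright> Delta \<degree> Delta"
    unfolding Delta_def using red.beta[of "Var 0 \<degree> Var 0"] by simp
  then show ?thesis unfolding SN_def by (auto intro!: exI[of _ "\<lambda>_. Delta \<degree> Delta"])
qed

primrec reaches :: "nat \<Rightarrow> trm \<Rightarrow> trm \<Rightarrow> bool" where
  "reaches 0 t u \<longleftrightarrow> t = u"
| "reaches (Suc n) t u \<longleftrightarrow> list_ex (\<lambda>t'. reaches n t' u) (reducts t)"

lemma not_SN_reaches: "reaches n t u \<Longrightarrow> u \<notin> SN \<Longrightarrow> t \<notin> SN"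
  by (induction n arbitrary: t) (auto simp: list_ex_iff set_reducts dest: not_SN_red)

lemma M1_M0_not_SN: "M\<^sub>1 \<degree> M\<^sub>0 \<notin> SN"
proof (rule not_SN_reaches)
  \<comment> \<open>Two steps unfold the terms to \<open>P P 0 1\<close>, three feed
    \<open>P_trm\<close>, and three selections by a Boolean take two steps each.\<close>
  show "reaches 11 (M\<^sub>1 \<degree> M\<^sub>0) (Delta \<degree> Delta)" by code_simp
qed (rule Delta_Delta_not_SN)

theorem proposition4p4:
  shows "subst M_trm (Mu N_trm) 0 \<in> SN \<and> Lam M_trm \<degree> Mu N_trm \<notin> SN"
proof
  interpret a0: argument M\<^sub>0 by (rule argument_M)
  interpret a1: argument M\<^sub>1 by (rule argument_M)
  have "subst M_trm (Mu N_trm) 0 = Lam (Var 0 \<degree> (Mu N_trm \<degree> M\<^sub>1) \<degree> (Mu N_trm \<degree> M\<^sub>0))"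
    using a0.closed a1.closed by (simp add: M_trm_def pair_def N_trm_def)
  moreover have "sn (Var 0 \<degree> (Mu N_trm \<degree> M\<^sub>1) \<degree> (Mu N_trm \<degree> M\<^sub>0))"
    \<comment> \<open>The variable applied to the first component is an \<open>fstage\<close> for
      \<open>M\<^sub>1\<close>; the second component is a stage for
      \<open>M\<^sub>0\<close>.\<close>
    by (rule sn_fstage_stage[OF argument_M(2,1)])
       (auto intro: a1.fstage.intros a1.stage.intros a0.stage.intros)
  ultimately show "subst M_trm (Mu N_trm) 0 \<in> SN"
    by (simp add: sn_Lam sn_imp_SN)
next
  let ?L = "Lam M_trm"
  \<comment> \<open>The argument left under the outer \<alpha> once \<open>mu'\<close> has passed
    \<open>?L\<close> to both occurrences of \<alpha> in \<open>N_trm\<close>.\<close>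
  define W where "W = Lam (Named 0 (?L \<degree> Var 0))"
  have M: "lclosed 0 M\<^sub>0" "lclosed 0 M\<^sub>1"
    using argument_M by (auto simp: argument_def)
  then have L: "lclosed 0 ?L"
    by (simp add: M_trm_def pair_def)
       (simp add: M\<^sub>0_def M\<^sub>1_def P_trm_def zero_trm_def one_trm_def Delta_def)
  \<comment> \<open>The condition says that \<open>u\<close> has no free \<lambda>-variable, so it
    may move under the binder of the pair unchanged.\<close>
  have L_red: "?L \<degree> u \<triangleright> Lam (Var 0 \<degree> (u \<degree> M\<^sub>1) \<degree> (u \<degree> M\<^sub>0))" if "lift_lam u 0 = u" for u
    using red.beta[of M_trm u] that M by (simp add: M_trm_def pair_def)
  \<comment> \<open>The divergent \<open>M\<^sub>1 \<degree> M\<^sub>0\<close> is the second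
    component of the resulting pair.\<close>
  have "?L \<degree> M\<^sub>1 \<notin> SN"
    using M by (intro not_SN_red[OF L_red] not_SN_Lam not_SN_appR M1_M0_not_SN) simp
  then have "Named 0 (?L \<degree> M\<^sub>1) \<notin> SN"
    by (rule not_SN_Named)
  moreover have "W \<degree> M\<^sub>1 \<triangleright> Named 0 (?L \<degree> M\<^sub>1)"
    using red.beta[of "Named 0 (?L \<degree> Var 0)" "M\<^sub>1"] lclosed_subst[OF L, of 0 "M\<^sub>1"]
    by (simp add: W_def del: subst.simps(2))
  ultimately have "W \<degree> M\<^sub>1 \<notin> SN"
    by (rule not_SN_red[rotated])
  moreover have "lift_lam W 0 = W"
    using lclosed_lift_lam[OF L, of 1] by (simp add: W_def)
  \<comment> \<open>This time the divergence sits in the first component,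
    \<open>W \<degree> M\<^sub>1\<close>.\<close>
  ultimately have "?L \<degree> W \<notin> SN"
    using not_SN_red[OF L_red not_SN_Lam[OF not_SN_appL[OF not_SN_appR]]] by blast
  then have "Mu (Named 0 (?L \<degree> W)) \<notin> SN"
    by (intro not_SN_Mu not_SN_Named)
  moreover have "?L \<degree> Mu N_trm \<triangleright> Mu (Named 0 (?L \<degree> W))"
    using red.mu'[of ?L N_trm] lclosed_lift_mu[OF L, of 0] lclosed_lift_lam[OF L, of 0]
    by (simp add: N_trm_def W_def)
  ultimately show "?L \<degree> Mu N_trm \<notin> SN"
    by (rule not_SN_red[rotated])
qed

end
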